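(* For every partition $U=(S_1,\dots,S_N)$ of the target area $\Omega$, every AP deployment $P=(p_1,\dots,p_N)\in(\mathbb{R}^2)^N$, every FC deployment $Q=(q_1,\dots,q_M)\in(\mathbb{R}^2)^M$, and every index map $T:\{1,\dots,N\}\to\{1,\dots,M\}$, $$D(P,Q,U,T)\;\ge\; D\big(P,Q,\mathbf{V}(P,Q,T),T\big),$$ where $D$ is the two-tier distortion and $\mathbf{V}(P,Q,T)$ is the generalized Voronoi diagram of $(P,Q,T)$.
   Context: Setting. $\Omega\subset\mathbb{R}^2$ is a convex polygon including its interior (compact, with nonempty interior). $N\ge M\ge 1$ are integers; $\mathcal{I_A}=\{1,\dots,N\}$ indexes access points (APs) and $\mathcal{I_B}=\{1,\dots,M\}$ indexes fusion centers (FCs). $f:\Omega\to\mathbb{R}^+=(0,\infty)$ is a continuous and differentiable density. The constants $a_n>0$ ($n\in\mathcal{I_A}$), $b_{n,m}>0$ ($n\in\mathcal{I_A}$, $m\in\mathcal{I_B}$) and $\beta>0$ are given. $\|\cdot\|$ is the Euclidean norm. An AP deployment is $P=(p_1,\dots,p_N)$ with $p_n\in\mathbb{R}^2$; an FC deployment is $Q=(q_1,\dots,q_M)$ with $q_m\in\mathbb{R}^2$; an index map is a function $T:\mathcal{I_A}\to\mathcal{I_B}$; a partition of $\Omega$ is a tuple $\mathbf{R}=(R_1,\dots,R_N)$ of pairwise disjoint Borel sets (possibly empty) with union $\Omega$. The two-tier distortion is $$D(P,Q,\mathbf{R},T)=\sum_{n=1}^N\int_{R_n}\left(a_n\|p_n-w\|^2+\beta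 b_{n,T(n)}\|p_n-q_{T(n)}\|^2\right)f(w)\,dw .$$ The generalized Voronoi diagram is $\mathbf{V}(P,Q,T)=(V_1,\dots,V_N)$, where $$V_n=\{w\in\Omega:\ a_n\|p_n-w\|^2+\beta b_{n,T(n)}\|p_n-q_{T(n)}\|^2\le a_k\|p_k-w\|^2+\beta b_{k,T(k)}\|p_k-q_{T(k)}\|^2\ \ \forall k\ne n\},$$ with ties broken in favor of the smaller index (a point $w$ attaining the minimum for several indices is assigned only to the cell of the smallest such index), so that $\mathbf{V}(P,Q,T)$ is a partition of $\Omega$ into Borel sets. *)

theory Defs
  imports "HOL-Analysis.Analysis"
begin

text \<open>
  Access points and fusion centers are indexed by \<open>{1..N}\<close> and \<open>{1..M}\<close>.  Deployments, index maps
  and tuples of cells are functions on \<open>nat\<close> of which only the values on these index sets matter.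
\<close>

definition two_tier_cost ::
  "(nat \<Rightarrow> real) \<Rightarrow> (nat \<Rightarrow> nat \<Rightarrow> real) \<Rightarrow> real \<Rightarrow> (nat \<Rightarrow> real^2) \<Rightarrow> (nat \<Rightarrow> real^2) \<Rightarrow> (nat \<Rightarrow> nat)
    \<Rightarrow> nat \<Rightarrow> real^2 \<Rightarrow> real"
where
  "two_tier_cost a b \<beta> P Q T n w =
     a n * (norm (P n - w))\<^sup>2 + \<beta> * b n (T n) * (norm (P n - Q (T n)))\<^sup>2"

definition two_tier_distortion ::
  "nat \<Rightarrow> (nat \<Rightarrow> real) \<Rightarrow> (nat \<Rightarrow> nat \<Rightarrow> real) \<Rightarrow> real \<Rightarrow> (real^2 \<Rightarrow> real)
    \<Rightarrow> (nat \<Rightarrow> real^2) \<Rightarrow> (nat \<Rightarrow> real^2) \<Rightarrow> (nat \<Rightarrow> (real^2) set) \<Rightarrow> (nat \<Rightarrow> nat) \<Rightarrow> real"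
where
  "two_tier_distortion N a b \<beta> f P Q R T =
     (\<Sum>n=1..N. LINT w:R n|lborel. two_tier_cost a b \<beta> P Q T n w * f w)"

definition borel_partition :: "nat \<Rightarrow> (real^2) set \<Rightarrow> (nat \<Rightarrow> (real^2) set) \<Rightarrow> bool"
where
  "borel_partition N \<Omega> R \<longleftrightarrow>
     (\<forall>n\<in>{1..N}. R n \<in> sets borel) \<and> disjoint_family_on R {1..N} \<and> (\<Union>n\<in>{1..N}. R n) = \<Omega>"

definition closed_voronoi_cell ::
  "nat \<Rightarrow> (real^2) set \<Rightarrow> (nat \<Rightarrow> real) \<Rightarrow> (nat \<Rightarrow> nat \<Rightarrow> real) \<Rightarrow> real
    \<Rightarrow> (nat \<Rightarrow> real^2) \<Rightarrow> (nat \<Rightarrow> real^2) \<Rightarrow> (nat \<Rightarrow> nat) \<Rightarrow> nat \<Rightarrow> (real^2) set"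
where
  "closed_voronoi_cell N \<Omega> a b \<beta> P Q T n =
     {w \<in> \<Omega>. \<forall>k\<in>{1..N} - {n}. two_tier_cost a b \<beta> P Q T n w \<le> two_tier_cost a b \<beta> P Q T k w}"

text \<open>Removing the cells of smaller index breaks ties in favor of the smallest minimizing index.\<close>

definition generalized_voronoi ::
  "nat \<Rightarrow> (real^2) set \<Rightarrow> (nat \<Rightarrow> real) \<Rightarrow> (nat \<Rightarrow> nat \<Rightarrow> real) \<Rightarrow> real
    \<Rightarrow> (nat \<Rightarrow> real^2) \<Rightarrow> (nat \<Rightarrow> real^2) \<Rightarrow> (nat \<Rightarrow> nat) \<Rightarrow> nat \<Rightarrow> (real^2) set"
where
  "generalized_voronoi N \<Omega> a b \<beta> P Q T n =
     closed_voronoi_cell N \<Omega> a b \<beta> P Q T n - (\<Union>k\<in>{1..<n}. closed_voronoi_cell N \<Omega> a b \<beta> P Q T k)"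

end

theory Submission
  imports Defs
begin

text \<open>
  The distortion of a partition is the integral over \<open>\<Omega>\<close> of a single function, whose value at \<open>w\<close>
  is \<open>f w\<close> times the cost of the index whose cell contains \<open>w\<close>.  For the Voronoi partition this
  index minimizes the cost, so the integrands compare pointwise.
\<close>

lemma sum_indicator_disjoint_family:
  fixes g :: "'i \<Rightarrow> real"
  assumes "finite I" "disjoint_family_on R I" "n \<in> I" "w \<in> R n"
  shows "(\<Sum>k\<in>I. indicator (R k) w * g k) = g n"
proof -
  have "indicator (R k) w * g k = (if k = n then g n else 0)" if "k \<in> I" for k
    using assms that by (auto simp: disjoint_family_on_def indicator_def)
  then show ?thesis
    using assms by (simp cong: sum.cong)
qed

text \<open>By linearity each side is a single integral of the indicator-weighted sum. At a point of
  \<open>\<Omega>\<close> exactly one term of each sum survives, and \<open>le\<close> compares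
  these two; outside \<open>\<Omega>\<close> both sums vanish. Integrability on every cell licenses
  both the exchange of sum and integral and the monotonicity.\<close>

lemma sum_set_integral_partition_mono:
  fixes g :: "'i \<Rightarrow> 'a \<Rightarrow> real"
  assumes fin: "finite I"
    and R: "disjoint_family_on R I" "(\<Union>n\<in>I. R n) = \<Omega>"
    and R': "disjoint_family_on R' I" "(\<Union>n\<in>I. R' n) = \<Omega>"
    and int: "\<And>n. n \<in> I \<Longrightarrow> set_integrable \<mu> (R n) (g n)"
    and int': "\<And>n. n \<in> I \<Longrightarrow> set_integrable \<mu> (R' n) (g n)"
    and le: "\<And>n k w. n \<in> I \<Longrightarrow> k \<in> I \<Longrightarrow> w \<in> R n \<Longrightarrow> w \<in> R' k \<Longrightarrow> g n w \<le> g k w"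
  shows "(\<Sum>n\<in>I. LINT w:R n|\<mu>. g n w) \<le> (\<Sum>n\<in>I. LINT w:R' n|\<mu>. g n w)"
proof -
  have integrable: "integrable \<mu> (\<lambda>w. indicator (R n) w * g n w)"
    "integrable \<mu> (\<lambda>w. indicator (R' n) w * g n w)" if "n \<in> I" for n
    using int[OF that] int'[OF that] by (simp_all add: set_integrable_def)
  have "(\<Sum>n\<in>I. indicator (R n) w * g n w) \<le> (\<Sum>n\<in>I. indicator (R' n) w * g n w)" for w
  proof (cases "w \<in> \<Omega>")
    case True
    then obtain n k where "n \<in> I" "w \<in> R n" "k \<in> I" "w \<in> R' k"
      using R R' by blast
    then have "(\<Sum>n\<in>I. indicator (R n) w * g n w) = g n w"
      "(\<Sum>n\<in>I. indicator (R' n) w * g n w) = g k w" "g n w \<le> g k w"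
      using sum_indicator_disjoint_family[OF fin R(1), of n w "\<lambda>n. g n w"]
        sum_indicator_disjoint_family[OF fin R'(1), of k w "\<lambda>n. g n w"] le by blast+
    then show ?thesis by simp
  next
    case False
    then have "w \<notin> R n" "w \<notin> R' n" if "n \<in> I" for n
      using R R' that by blast+
    then show ?thesis by simp
  qed
  then have "(LINT w|\<mu>. (\<Sum>n\<in>I. indicator (R n) w * g n w))
      \<le> (LINT w|\<mu>. (\<Sum>n\<in>I. indicator (R' n) w * g n w))"
    by (intro integral_mono Bochner_Integration.integrable_sum integrable)
  then show ?thesis
    by (simp add: set_lebesgue_integral_def Bochner_Integration.integral_sum integrable)
qed

lemma continuous_on_two_tier_cost: "continuous_on A (two_tier_cost a b \<beta> P Q T n)"
  unfolding two_tier_cost_def by (intro continuous_intros)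

text \<open>Costs are continuous, so each pairwise comparison cuts out a closed set. This is the
  source of the Borel measurability of the Voronoi cells.\<close>

lemma closed_closed_voronoi_cell:
  assumes "closed \<Omega>"
  shows "closed (closed_voronoi_cell N \<Omega> a b \<beta> P Q T n)"
proof -
  have "closed_voronoi_cell N \<Omega> a b \<beta> P Q T n =
      \<Omega> \<inter> (\<Inter>k\<in>{1..N} - {n}. {w. two_tier_cost a b \<beta> P Q T n w \<le> two_tier_cost a b \<beta> P Q T k w})"
    by (auto simp: closed_voronoi_cell_def)
  then show ?thesis
    using assms by (auto intro!: closed_Int closed_INT closed_Collect_le continuous_on_two_tier_cost)
qed

text \<open>Tie-breaking only shrinks the closed cell, so its inequalities survive. The case
  \<open>k = n\<close>, which the definition excludes, is trivial.\<close>

lemma generalized_voronoi_cost_le: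
  assumes "w \<in> generalized_voronoi N \<Omega> a b \<beta> P Q T n" "k \<in> {1..N}"
  shows "two_tier_cost a b \<beta> P Q T n w \<le> two_tier_cost a b \<beta> P Q T k w"
  using assms by (cases "k = n") (auto simp: generalized_voronoi_def closed_voronoi_cell_def)

text \<open>Since \<open>{1..N}\<close> is finite and nonempty, some index minimizes the cost at a
  given point, and its closed cell contains that point.\<close>

lemma Union_closed_voronoi_cell:
  assumes "1 \<le> N"
  shows "(\<Union>n\<in>{1..N}. closed_voronoi_cell N \<Omega> a b \<beta> P Q T n) = \<Omega>"
proof
  show "\<Omega> \<subseteq> (\<Union>n\<in>{1..N}. closed_voronoi_cell N \<Omega> a b \<beta> P Q T n)"
  proof
    fix w assume "w \<in> \<Omega>"
    let ?c = "\<lambda>n. two_tier_cost a b \<beta> P Q T n w"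
    have "finite {1..N}" "{1..N} \<noteq> {}" using assms by auto
    then obtain n where "n \<in> {1..N}" "\<And>k. k \<in> {1..N} \<Longrightarrow> ?c n \<le> ?c k"
      using arg_min_if_finite(1)[of "{1..N}" ?c] arg_min_least[of "{1..N}" _ ?c] by blast
    with \<open>w \<in> \<Omega>\<close> show "w \<in> (\<Union>n\<in>{1..N}. closed_voronoi_cell N \<Omega> a b \<beta> P Q T n)"
      unfolding closed_voronoi_cell_def by blast
  qed
qed (auto simp: closed_voronoi_cell_def)

lemma borel_partition_generalized_voronoi:
  assumes "closed \<Omega>" "1 \<le> N"
  shows "borel_partition N \<Omega> (generalized_voronoi N \<Omega> a b \<beta> P Q T)"
proof -
  let ?C = "closed_voronoi_cell N \<Omega> a b \<beta> P Q T"
  let ?V = "generalized_voronoi N \<Omega> a b \<beta> P Q T"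
  have "?V n \<in> sets borel" for n
    unfolding generalized_voronoi_def
    by (intro sets.Diff sets.finite_UN borel_closed closed_closed_voronoi_cell assms) auto
  moreover have "disjoint_family_on ?V {1..N}"
  proof -
    \<comment> \<open>The larger index \<open>n\<close> has the whole closed cell of
      \<open>m\<close> subtracted, and \<open>?V m\<close> lies inside that cell. The bound
      \<open>1 \<le> m\<close> places \<open>m\<close> in \<open>{1..<n}\<close>.\<close>
    have "?V m \<inter> ?V n = {}" if "m < n" "m \<in> {1..N}" for m n
      using that by (auto simp: generalized_voronoi_def)
    then show ?thesis
      unfolding disjoint_family_on_def by (metis Int_commute linorder_neqE_nat)
  qed
  moreover have "(\<Union>n\<in>{1..N}. ?V n) = (\<Union>n\<in>{1..N}. ?C n)"
  proof
    show "(\<Union>n\<in>{1..N}. ?C n) \<subseteq> (\<Union>n\<in>{1..N}. ?V n)"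
    proof
      fix w assume "w \<in> (\<Union>n\<in>{1..N}. ?C n)"
      then have ex: "\<exists>n. n \<in> {1..N} \<and> w \<in> ?C n" by auto
      \<comment> \<open>The least index whose closed cell contains \<open>w\<close> is the one that
        tie-breaking selects: by minimality \<open>w\<close> lies in none of the subtracted
        cells.\<close>
      define n where "n = (LEAST n. n \<in> {1..N} \<and> w \<in> ?C n)"
      have n: "n \<in> {1..N}" "w \<in> ?C n"
        using LeastI_ex[OF ex] by (simp_all add: n_def)
      have "w \<notin> ?C k" if "k \<in> {1..<n}" for k
        using not_less_Least[of k "\<lambda>n. n \<in> {1..N} \<and> w \<in> ?C n", folded n_def] that n(1)
        by auto
      with n show "w \<in> (\<Union>n\<in>{1..N}. ?V n)"
        by (auto simp: generalized_voronoi_def)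
    qed
  qed (auto simp: generalized_voronoi_def)
  ultimately show ?thesis
    using Union_closed_voronoi_cell[OF assms(2)] by (simp add: borel_partition_def)
qed

text \<open>A continuous integrand is integrable over the compact set \<open>\<Omega>\<close>, and
  integrability passes to Borel subsets.\<close>

lemma set_integrable_two_tier_cost:
  assumes "compact \<Omega>" "continuous_on \<Omega> f" "A \<in> sets borel" "A \<subseteq> \<Omega>"
  shows "set_integrable lborel A (\<lambda>w. two_tier_cost a b \<beta> P Q T n w * f w)"
proof (rule set_integrable_subset)
  show "set_integrable lborel \<Omega> (\<lambda>w. two_tier_cost a b \<beta> P Q T n w * f w)"
    unfolding set_integrable_def
    by (intro borel_integrable_compact continuous_on_mult continuous_on_two_tier_cost assms)
qed (use assms in auto)

theorem proposition1:
  fixes \<Omega> :: "(real^2) set"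
    and N M :: nat
    and f :: "real^2 \<Rightarrow> real"
    and a :: "nat \<Rightarrow> real"
    and b :: "nat \<Rightarrow> nat \<Rightarrow> real"
    and \<beta> :: real
    and S :: "nat \<Rightarrow> (real^2) set"
    and P Q :: "nat \<Rightarrow> real^2"
    and T :: "nat \<Rightarrow> nat"
  assumes "polytope \<Omega>" and "interior \<Omega> \<noteq> {}"
    and "1 \<le> M" and "M \<le> N"
    and "continuous_on \<Omega> f" and "f differentiable_on \<Omega>" and "\<And>w. w \<in> \<Omega> \<Longrightarrow> f w > 0"
    and "\<And>n. n \<in> {1..N} \<Longrightarrow> a n > 0"
    and "\<And>n m. n \<in> {1..N} \<Longrightarrow> m \<in> {1..M} \<Longrightarrow> b n m > 0"
    and "\<beta> > 0"
    and "borel_partition N \<Omega> S"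
    and "T \<in> {1..N} \<rightarrow> {1..M}"
  shows "two_tier_distortion N a b \<beta> f P Q S T
           \<ge> two_tier_distortion N a b \<beta> f P Q (generalized_voronoi N \<Omega> a b \<beta> P Q T) T"
proof -
  let ?V = "generalized_voronoi N \<Omega> a b \<beta> P Q T"
  have \<Omega>: "compact \<Omega>"
    using assms(1) by (rule polytope_imp_compact)
  have V: "borel_partition N \<Omega> ?V"
    using assms(3,4) by (intro borel_partition_generalized_voronoi compact_imp_closed \<Omega>) simp
  have integrable: "set_integrable lborel (R n) (\<lambda>w. two_tier_cost a b \<beta> P Q T n w * f w)"
    if "borel_partition N \<Omega> R" "n \<in> {1..N}" for R n
    using that by (intro set_integrable_two_tier_cost[OF \<Omega> assms(5)]) (auto simp: borel_partition_def)
  show ?thesis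
    unfolding two_tier_distortion_def
  \<comment> \<open>The Voronoi cells take the role of \<open>R\<close> and the cells of
    \<open>S\<close> that of \<open>R'\<close>, with cost times density as integrand.\<close>
  proof (rule sum_set_integral_partition_mono)
    fix n k w assume nk: "n \<in> {1..N}" "k \<in> {1..N}" and w: "w \<in> ?V n" "w \<in> S k"
    \<comment> \<open>The density is known to be positive only on \<open>\<Omega>\<close>, and its
      sign is what lets the cost inequality be multiplied by \<open>f w\<close>.\<close>
    have "w \<in> \<Omega>"
      using nk w assms(11) by (auto simp: borel_partition_def)
    then show "two_tier_cost a b \<beta> P Q T n w * f w \<le> two_tier_cost a b \<beta> P Q T k w * f w"
      using generalized_voronoi_cost_le[OF w(1) nk(2)] assms(7) by (simp add: mult_right_mono less_imp_le)
  qed (use V assms(11) integrable in \<open>auto simp: borel_partition_def\<close>)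
qed

end
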